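(* Let $e$ be an empirical model on a measurement scenario $\langle X,\mathcal{M},\mathbf{O}\rangle$, and let $e^{\mathrm{bin}}$ be any discrete-variable empirical model obtained from $e$ by binning. Then contextuality of $e^{\mathrm{bin}}$ witnesses contextuality of $e$ (i.e. if $e^{\mathrm{bin}}$ is contextual then so is $e$), and $\mathsf{CF}(e^{\mathrm{bin}})$ is a lower bound for $\mathsf{CF}(e)$: $$\mathsf{CF}(e^{\mathrm{bin}})\le \mathsf{CF}(e).$$
   Context: A measurement scenario $\langle X,\mathcal{M},\mathbf{O}\rangle$ consists of: a (possibly infinite) set $X$ of measurement labels; a family $\mathcal{M}$ of subsets of $X$ with $\bigcup\mathcal{M}=X$ that is an anti-chain for inclusion (its elements are called maximal contexts); and, for each $x\in X$, a measurable space $\mathbf{O}_x=\langle O_x,\mathcal{F}_x\rangle$. For $U\subseteq X$, $\mathbf{O}_U=\prod_{x\in U}\mathbf{O}_x$ is the product measurable space (product $\sigma$-algebra generated by cylinders), with underlying set $O_U$. For $U\subseteq V$ and a measure $\mu$ on $\mathbf{O}_V$, $\mu|_U$ denotes the marginal, i.e. the push-forward of $\mu$ along the projection $O_V\to O_U$. An empirical model $e$ on the scenario is a family $(e_C)_{C\in\mathcal{M}}$ with $e_C$ a probability measure on $\mathbf{O}_C$, such that $e_C|_{C\cap C'}=e_{C'}|_{C\cap C'}$ for all $C,C'\in\mathcal{M}$. It is noncontextual (extendable) if there is a probability measure $\mu$ on $\mathbf{O}_X$ with $\mu|_C=e_C$ for all $C\in\mathcal{M}$, and contextual otherwise. The noncontextual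 fraction of $e$ is $$\mathsf{NCF}(e)=\sup\{\mu(O_X)\;:\;\mu \text{ a (nonnegative) measure on }\mathbf{O}_X,\ \mu|_C\le e_C \text{ for all } C\in\mathcal{M}\}\in[0,1],$$ where $\le$ between measures is setwise; the contextual fraction is $\mathsf{CF}(e)=1-\mathsf{NCF}(e)$. Binning: given a family of measurable functions $t_x:\mathbf{O}_x\to\mathbf{O}'_x$, $x\in X$, where each $\mathbf{O}'_x$ is a finite set with the discrete $\sigma$-algebra (so that $t_x$ partitions $O_x$ into finitely many measurable bins), the binned empirical model $e^{\mathrm{bin}}$ on $\langle X,\mathcal{M},\mathbf{O}'\rangle$ is given by letting $e^{\mathrm{bin}}_C$ be the push-forward of $e_C$ along $\prod_{x\in C}t_x:\mathbf{O}_C\to\mathbf{O}'_C$, for each $C\in\mathcal{M}$. *)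

theory Defs
  imports "HOL-Probability.Probability"
begin

text \<open>
  The outcome spaces are a family \<open>Ob :: 'x \<Rightarrow> 'o measure\<close>, of which only \<open>space\<close> and \<open>sets\<close>
  matter: each \<open>Ob x\<close> plays the role of a measurable space, and a measure on the product over
  \<open>U\<close> is a measure whose sets are those of \<open>PiM U Ob\<close>, that is, the product sigma-algebra generated
  by cylinders (\<open>U\<close> may be infinite). Outcomes of all labels live in one type, but the carriers
  \<open>space (Ob x)\<close> are arbitrary subsets of it.
\<close>

definition measurement_scenario :: "'x set \<Rightarrow> 'x set set \<Rightarrow> bool" where
  "measurement_scenario X \<M> \<longleftrightarrow>
     \<Union>\<M> = X \<and> (\<forall>C\<in>\<M>. \<forall>C'\<in>\<M>. C \<subseteq> C' \<longrightarrow> C = C')"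

text \<open>Meaningful for \<open>\<mu>\<close> on the product over some \<open>V\<close> with \<open>U \<subseteq> V\<close>.\<close>

definition marginal :: "('x \<Rightarrow> 'o measure) \<Rightarrow> 'x set \<Rightarrow> ('x \<Rightarrow> 'o) measure \<Rightarrow> ('x \<Rightarrow> 'o) measure" where
  "marginal Ob U \<mu> = distr \<mu> (PiM U Ob) (\<lambda>\<omega>. restrict \<omega> U)"

definition empirical_model ::
  "'x set set \<Rightarrow> ('x \<Rightarrow> 'o measure) \<Rightarrow> ('x set \<Rightarrow> ('x \<Rightarrow> 'o) measure) \<Rightarrow> bool" where
  "empirical_model \<M> Ob e \<longleftrightarrow>
     (\<forall>C\<in>\<M>. prob_space (e C) \<and> sets (e C) = sets (PiM C Ob)) \<and>
     (\<forall>C\<in>\<M>. \<forall>C'\<in>\<M>. marginal Ob (C \<inter> C') (e C) = marginal Ob (C \<inter> C') (e C'))"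

definition noncontextual ::
  "'x set \<Rightarrow> 'x set set \<Rightarrow> ('x \<Rightarrow> 'o measure) \<Rightarrow> ('x set \<Rightarrow> ('x \<Rightarrow> 'o) measure) \<Rightarrow> bool" where
  "noncontextual X \<M> Ob e \<longleftrightarrow>
     (\<exists>\<mu>. prob_space \<mu> \<and> sets \<mu> = sets (PiM X Ob) \<and> (\<forall>C\<in>\<M>. marginal Ob C \<mu> = e C))"

abbreviation contextual ::
  "'x set \<Rightarrow> 'x set set \<Rightarrow> ('x \<Rightarrow> 'o measure) \<Rightarrow> ('x set \<Rightarrow> ('x \<Rightarrow> 'o) measure) \<Rightarrow> bool" where
  "contextual X \<M> Ob e \<equiv> \<not> noncontextual X \<M> Ob e"

text \<open>
  The order on measures is the library one; both sides have the same sets here, so it is the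
  setwise order by \<open>le_measure\<close>. The supremum is taken in \<open>ennreal\<close>.
\<close>

definition NCF ::
  "'x set \<Rightarrow> 'x set set \<Rightarrow> ('x \<Rightarrow> 'o measure) \<Rightarrow> ('x set \<Rightarrow> ('x \<Rightarrow> 'o) measure) \<Rightarrow> ennreal" where
  "NCF X \<M> Ob e =
     (SUP \<mu> \<in> {\<mu>. sets \<mu> = sets (PiM X Ob) \<and> (\<forall>C\<in>\<M>. marginal Ob C \<mu> \<le> e C)}.
        emeasure \<mu> (space (PiM X Ob)))"

text \<open>
  Subtraction on \<open>ennreal\<close> is truncated, but \<open>NCF \<le> 1\<close> as soon as there is a context, see
  \<open>NCF_le_1\<close> below. Without contexts \<open>X\<close> is empty, \<open>NCF\<close> is infinite and \<open>CF\<close> is \<open>0\<close>.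
\<close>

definition CF ::
  "'x set \<Rightarrow> 'x set set \<Rightarrow> ('x \<Rightarrow> 'o measure) \<Rightarrow> ('x set \<Rightarrow> ('x \<Rightarrow> 'o) measure) \<Rightarrow> ennreal" where
  "CF X \<M> Ob e = 1 - NCF X \<M> Ob e"

definition binning ::
  "'x set \<Rightarrow> ('x \<Rightarrow> 'o measure) \<Rightarrow> ('x \<Rightarrow> 'p set) \<Rightarrow> ('x \<Rightarrow> 'o \<Rightarrow> 'p) \<Rightarrow> bool" where
  "binning X Ob B t \<longleftrightarrow>
     (\<forall>x\<in>X. finite (B x) \<and> t x \<in> measurable (Ob x) (count_space (B x)))"

abbreviation bin_spaces :: "('x \<Rightarrow> 'p set) \<Rightarrow> 'x \<Rightarrow> 'p measure" where
  "bin_spaces B \<equiv> (\<lambda>x. count_space (B x))"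

definition binned_model ::
  "('x \<Rightarrow> 'p set) \<Rightarrow> ('x \<Rightarrow> 'o \<Rightarrow> 'p) \<Rightarrow> ('x set \<Rightarrow> ('x \<Rightarrow> 'o) measure) \<Rightarrow>
     'x set \<Rightarrow> ('x \<Rightarrow> 'p) measure" where
  "binned_model B t e C = distr (e C) (PiM C (bin_spaces B)) (\<lambda>\<omega>. \<lambda>x\<in>C. t x (\<omega> x))"

lemma NCF_le_1:
  fixes Ob :: "'x \<Rightarrow> 'o measure"
  assumes "measurement_scenario X \<M>" and "empirical_model \<M> Ob e" and "\<M> \<noteq> {}"
  shows "NCF X \<M> Ob e \<le> 1"
  unfolding NCF_def
proof (rule SUP_least, clarify)
  fix \<mu> :: "('x \<Rightarrow> 'o) measure"
  assume \<mu>: "sets \<mu> = sets (PiM X Ob)" and le: "\<forall>C\<in>\<M>. marginal Ob C \<mu> \<le> e C"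
  obtain C where C: "C \<in> \<M>" using assms(3) by blast
  then have CX: "C \<subseteq> X" using assms(1) by (auto simp: measurement_scenario_def)
  have e: "prob_space (e C)" "sets (e C) = sets (PiM C Ob)"
    using assms(2) C by (auto simp: empirical_model_def)
  have sp: "space \<mu> = space (PiM X Ob)" "space (e C) = space (PiM C Ob)"
    using \<mu> e(2) by (auto dest: sets_eq_imp_space_eq)
  have m: "(\<lambda>\<omega>. restrict \<omega> C) \<in> measurable \<mu> (PiM C Ob)"
    using measurable_restrict_subset[OF CX, of Ob] \<mu> measurable_cong_sets by blast
  have "emeasure \<mu> (space (PiM X Ob)) = emeasure (marginal Ob C \<mu>) (space (PiM C Ob))"
    unfolding marginal_def
    using measurable_space[OF m]
    by (subst emeasure_distr[OF m]) (auto simp: sp(1)[symmetric] intro!: arg_cong[of _ _ "emeasure \<mu>"])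
  also have "\<dots> \<le> emeasure (e C) (space (PiM C Ob))"
    using le C e(2) le_measure[of "marginal Ob C \<mu>" "e C"] by (auto simp: marginal_def)
  also have "\<dots> = 1"
    using prob_space.emeasure_space_1[OF e(1)] sp(2) by simp
  finally show "emeasure \<mu> (space (PiM X Ob)) \<le> 1" .
qed

lemma empirical_model_binned:
  assumes sc: "measurement_scenario X \<M>" and em: "empirical_model \<M> Ob e"
    and b: "binning X Ob B t"
  shows "empirical_model \<M> (bin_spaces B) (binned_model B t e)"
proof -
  have tm: "(\<lambda>\<omega>. \<lambda>x\<in>D. t x (\<omega> x)) \<in> measurable (PiM D Ob) (PiM D (bin_spaces B))"
    if "D \<subseteq> X" for D
  proof (rule measurable_restrict)
    fix x assume x: "x \<in> D"
    then have "t x \<in> measurable (Ob x) (count_space (B x))"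
      using b that by (auto simp: binning_def)
    then show "(\<lambda>\<omega>. t x (\<omega> x)) \<in> measurable (PiM D Ob) (count_space (B x))"
      using x measurable_component_singleton[of x D Ob] measurable_compose by blast
  qed
  have sub: "C \<subseteq> X" if "C \<in> \<M>" for C
    using sc that by (auto simp: measurement_scenario_def)
  have e: "prob_space (e C)" "sets (e C) = sets (PiM C Ob)" if "C \<in> \<M>" for C
    using em that by (auto simp: empirical_model_def)
  have tme: "(\<lambda>\<omega>. \<lambda>x\<in>C. t x (\<omega> x)) \<in> measurable (e C) (PiM C (bin_spaces B))" if "C \<in> \<M>" for C
    using tm[OF sub[OF that]] e(2)[OF that] measurable_cong_sets by blast
  have key: "marginal (bin_spaces B) D (binned_model B t e C) =
      distr (marginal Ob D (e C)) (PiM D (bin_spaces B)) (\<lambda>\<omega>. \<lambda>x\<in>D. t x (\<omega> x))"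
    if C: "C \<in> \<M>" and D: "D \<subseteq> C" for C D
  proof -
    have r: "(\<lambda>\<omega>. restrict \<omega> D) \<in> measurable (e C) (PiM D Ob)"
      using measurable_restrict_subset[OF D, of Ob] e(2)[OF C] measurable_cong_sets by blast
    have D': "D \<subseteq> X" using D sub[OF C] by blast
    show ?thesis
      unfolding marginal_def binned_model_def
      apply (subst distr_distr[OF measurable_restrict_subset[OF D] tme[OF C]])
      apply (subst distr_distr[OF tm[OF D'] r])
      using D by (intro distr_cong) (auto simp: restrict_def fun_eq_iff)
  qed
  have "marginal (bin_spaces B) (C \<inter> C') (binned_model B t e C) =
        marginal (bin_spaces B) (C \<inter> C') (binned_model B t e C')"
    if "C \<in> \<M>" "C' \<in> \<M>" for C C'
    using em that key[of C "C \<inter> C'"] key[of C' "C \<inter> C'"] by (auto simp: empirical_model_def)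
  moreover have "prob_space (binned_model B t e C)" if "C \<in> \<M>" for C
    unfolding binned_model_def by (rule prob_space.prob_space_distr[OF e(1)[OF that] tme[OF that]])
  ultimately show ?thesis
    by (auto simp: empirical_model_def binned_model_def)
qed

end

theory Submission
  imports Defs
begin

text \<open>
  Pushing a measure on the global outcome space forward along the product of the bin maps commutes
  with taking marginals, and it preserves total mass and the setwise order. Hence a global measure
  witnessing noncontextuality, or any measure admissible in the noncontextual fraction, is carried
  to one for the binned model.
\<close>

abbreviation bin_measure ::
  "('x \<Rightarrow> 'p set) \<Rightarrow> ('x \<Rightarrow> 'o \<Rightarrow> 'p) \<Rightarrow> 'x set \<Rightarrow> ('x \<Rightarrow> 'o) measure \<Rightarrow> ('x \<Rightarrow> 'p) measure" where
  "bin_measure B t U \<mu> \<equiv> distr \<mu> (PiM U (bin_spaces B)) (\<lambda>\<omega>. \<lambda>x\<in>U. t x (\<omega> x))"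

text \<open>Each value of a push-forward is the value of the original measure on a preimage, so a
  setwise inequality is inherited. Equality of \<open>sets\<close> makes the order on measures the
  setwise one.\<close>

lemma distr_mono_measure:
  assumes "M \<le> N" and sets: "sets M = sets N" and f: "f \<in> measurable M K"
  shows "distr M K f \<le> distr N K f"
proof -
  have f': "f \<in> measurable N K"
    using f sets measurable_cong_sets by blast
  \<comment> \<open>Outside the common sigma-algebra both values default to 0, so the inequality
    holds for every \<open>A\<close> and can be used at any preimage.\<close>
  have "emeasure M A \<le> emeasure N A" for A
    using assms(1) le_measure[OF sets] sets
    by (cases "A \<in> sets M") (auto simp: emeasure_notin_sets)
  then show ?thesis
    using sets_eq_imp_space_eq[OF sets]
    by (subst le_measure) (auto simp: emeasure_distr[OF f] emeasure_distr[OF f'])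
qed

lemma measurable_bin:
  assumes "binning X Ob B t" and "U \<subseteq> X" and "sets \<mu> = sets (PiM U Ob)"
  shows "(\<lambda>\<omega>. \<lambda>x\<in>U. t x (\<omega> x)) \<in> measurable \<mu> (PiM U (bin_spaces B))"
proof -
  have "(\<lambda>\<omega>. t x (\<omega> x)) \<in> measurable (PiM U Ob) (count_space (B x))" if "x \<in> U" for x
  proof (rule measurable_compose[OF measurable_component_singleton[OF that]])
    show "t x \<in> measurable (Ob x) (count_space (B x))"
      using assms(1,2) that by (auto simp: binning_def)
  qed
  then have "(\<lambda>\<omega>. \<lambda>x\<in>U. t x (\<omega> x)) \<in> measurable (PiM U Ob) (PiM U (bin_spaces B))"
    by (rule measurable_restrict)
  then show ?thesis
    using assms(3) measurable_cong_sets by blast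
qed

text \<open>Binning acts on each coordinate separately, so restricting to \<open>U\<close> after
  binning is the same map as binning after restricting. Both sides push \<mu> forward along
  it.\<close>

lemma marginal_bin_measure:
  assumes b: "binning X Ob B t" and V: "V \<subseteq> X" and U: "U \<subseteq> V"
    and sets: "sets \<mu> = sets (PiM V Ob)"
  shows "marginal (bin_spaces B) U (bin_measure B t V \<mu>) = bin_measure B t U (marginal Ob U \<mu>)"
proof -
  have r: "(\<lambda>\<omega>. restrict \<omega> U) \<in> measurable \<mu> (PiM U Ob)"
    using measurable_restrict_subset[OF U, of Ob] sets measurable_cong_sets by blast
  have UX: "U \<subseteq> X" using U V by blast
  show ?thesis
    unfolding marginal_def
    apply (subst distr_distr[OF measurable_restrict_subset[OF U] measurable_bin[OF b V sets]])
    apply (subst distr_distr[OF measurable_bin[OF b UX refl] r])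
    using U by (intro distr_cong) (auto simp: restrict_def fun_eq_iff)
qed

lemma noncontextual_binned:
  assumes sc: "measurement_scenario X \<M>" and b: "binning X Ob B t"
    and nc: "noncontextual X \<M> Ob e"
  shows "noncontextual X \<M> (bin_spaces B) (binned_model B t e)"
proof -
  obtain \<mu> where \<mu>: "prob_space \<mu>" "sets \<mu> = sets (PiM X Ob)" "\<forall>C\<in>\<M>. marginal Ob C \<mu> = e C"
    using nc by (auto simp: noncontextual_def)
  have "marginal (bin_spaces B) C (bin_measure B t X \<mu>) = binned_model B t e C" if "C \<in> \<M>" for C
    using marginal_bin_measure[OF b subset_refl _ \<mu>(2), of C] sc \<mu>(3) that
    by (auto simp: measurement_scenario_def binned_model_def)
  moreover have "prob_space (bin_measure B t X \<mu>)"
    by (rule prob_space.prob_space_distr[OF \<mu>(1) measurable_bin[OF b subset_refl \<mu>(2)]])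
  ultimately show ?thesis
    unfolding noncontextual_def by (intro exI[of _ "bin_measure B t X \<mu>"]) auto
qed

lemma NCF_le_binned:
  fixes Ob :: "'x \<Rightarrow> 'o measure"
  assumes sc: "measurement_scenario X \<M>" and em: "empirical_model \<M> Ob e"
    and b: "binning X Ob B t"
  shows "NCF X \<M> Ob e \<le> NCF X \<M> (bin_spaces B) (binned_model B t e)"
  unfolding NCF_def
\<comment> \<open>The supremum need not be attained, so each admissible \<mu> is matched with an
  admissible measure of at least its mass.\<close>
proof (rule SUP_mono, clarify)
  fix \<mu> :: "('x \<Rightarrow> 'o) measure"
  assume \<mu>: "sets \<mu> = sets (PiM X Ob)" and le: "\<forall>C\<in>\<M>. marginal Ob C \<mu> \<le> e C"
  let ?\<nu> = "bin_measure B t X \<mu>"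
  have "marginal (bin_spaces B) C ?\<nu> \<le> binned_model B t e C" if C: "C \<in> \<M>" for C
  proof -
    have CX: "C \<subseteq> X" using sc C by (auto simp: measurement_scenario_def)
    have sets: "sets (marginal Ob C \<mu>) = sets (PiM C Ob)" "sets (e C) = sets (PiM C Ob)"
      using em C by (auto simp: marginal_def empirical_model_def)
    have "bin_measure B t C (marginal Ob C \<mu>) \<le> bin_measure B t C (e C)"
      using le C sets by (intro distr_mono_measure measurable_bin[OF b CX]) auto
    then show ?thesis
      by (simp add: marginal_bin_measure[OF b subset_refl CX \<mu>] binned_model_def)
  qed
  \<comment> \<open>Every outcome falls into some bin, so the preimage of the whole binned space is
    the whole of \<open>space \<mu>\<close>.\<close>
  moreover have "emeasure ?\<nu> (space (PiM X (bin_spaces B))) = emeasure \<mu> (space (PiM X Ob))"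
    using measurable_space[OF measurable_bin[OF b subset_refl \<mu>]] sets_eq_imp_space_eq[OF \<mu>]
    by (subst emeasure_distr[OF measurable_bin[OF b subset_refl \<mu>]])
       (auto intro!: arg_cong[of _ _ "emeasure \<mu>"])
  ultimately show "\<exists>\<nu>\<in>{\<nu>. sets \<nu> = sets (PiM X (bin_spaces B)) \<and>
        (\<forall>C\<in>\<M>. marginal (bin_spaces B) C \<nu> \<le> binned_model B t e C)}.
      emeasure \<mu> (space (PiM X Ob)) \<le> emeasure \<nu> (space (PiM X (bin_spaces B)))"
    by (intro bexI[of _ ?\<nu>]) auto
qed

theorem proposition1:
  fixes X :: "'x set" and \<M> :: "'x set set"
    and Ob :: "'x \<Rightarrow> 'o measure" and e :: "'x set \<Rightarrow> ('x \<Rightarrow> 'o) measure"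
    and B :: "'x \<Rightarrow> 'p set" and t :: "'x \<Rightarrow> 'o \<Rightarrow> 'p"
  assumes "measurement_scenario X \<M>"
    and "empirical_model \<M> Ob e"
    and "binning X Ob B t"
  shows "(contextual X \<M> (bin_spaces B) (binned_model B t e) \<longrightarrow> contextual X \<M> Ob e) \<and>
         CF X \<M> (bin_spaces B) (binned_model B t e) \<le> CF X \<M> Ob e"
  \<comment> \<open>Truncated subtraction from 1 is antitone also at infinite values, so the case of
    no contexts needs no separate treatment.\<close>
  using noncontextual_binned[OF assms(1,3)] NCF_le_binned[OF assms]
  by (auto simp: CF_def intro: ennreal_mono_minus)

end
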